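(* Let $\boldsymbol\varphi_d=(\varphi_{1,d},\varphi_{2,d})^{\mathsf T}$, with both components strictly positive, be the principal eigenfunction of the problem $$-d\varphi_i''-b_i(x)\varphi_i'+\sum_{j=1}^2M_{ij}(x)\varphi_j=\lambda\varphi_i\ \text{ in }(\ell,r),\qquad \varphi_i'(\ell)=\varphi_i'(r)=0,\qquad i=1,2,$$ normalized by $\max_{i,x}\varphi_{i,d}(x)=1$, and set $W_{i,d}=-d\log\varphi_{i,d}$. For every sequence $d_k\searrow0$ there is a subsequence along which $W_{1,d_k}$ and $W_{2,d_k}$ converge uniformly on $[\ell,r]$ to the same Lipschitz function $W$. The limit $W$ is a viscosity solution of the Hamilton-Jacobi problem $$\max_{1\le i\le2}\{|W'|^2-b_i(x)W'\}=0\ \text{ in }(\ell,r),\qquad W'(\ell)=W'(r)=0,\qquad \min_{x\in[\ell,r]}W(x)=0,$$ where the Neumann condition is understood in the relaxed viscosity sense.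
   Context: Setting: $\ell<r$, $d>0$, $b_1,b_2\in C^1([\ell,r])$, $\boldsymbol M=(M_{ij})\in C^1([\ell,r];\mathbb R^{2\times2})$ with $M_{12},M_{21}<0$ on $[\ell,r]$. By the Krein-Rutman theorem the eigenvalue problem has a real simple principal eigenvalue $\lambda(d)$, which is the eigenvalue with smallest real part and has an eigenfunction with both components strictly positive (the principal eigenfunction). Viscosity solution with relaxed Neumann condition: put $H(x,p)=\max_{i=1,2}\{p^2-b_i(x)p\}$ and let $\partial_\nu$ denote the outward derivative ($\partial_\nu\phi(\ell)=-\phi'(\ell)$, $\partial_\nu\phi(r)=\phi'(r)$). A continuous $W$ is a subsolution if, whenever $\phi\in C^2([\ell,r])$ and $W-\phi$ has a local maximum at $x_0$ (relative to $[\ell,r]$), $H(x_0,\phi'(x_0))\le0$ if $x_0\in(\ell,r)$, and $\min\{H(x_0,\phi'(x_0)),\partial_\nu\phi(x_0)\}\le0$ if $x_0\in\{\ell,r\}$. It is a supersolution if, whenever $W-\phi$ has a local minimum at $x_0$, $H(x_0,\phi'(x_0))\ge0$ if $x_0\in(\ell,r)$, and $\max\{H(x_0,\phi'(x_0)),\partial_\nu\phi(x_0)\}\ge0$ if $x_0\in\{\ell,r\}$. A solution is both. *)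

theory Defs
  imports "HOL-Analysis.Analysis"
begin

text \<open>
  Derivatives on \<open>[l, r]\<close> are taken within the interval, hence one-sided at the endpoints; the
  values of a function outside \<open>[l, r]\<close> never matter.
\<close>

definition C1_on :: "real set \<Rightarrow> (real \<Rightarrow> 'a::real_normed_vector) \<Rightarrow> bool" where
  "C1_on S f \<longleftrightarrow>
     (\<exists>f'. (\<forall>x\<in>S. (f has_vector_derivative f' x) (at x within S)) \<and> continuous_on S f')"

definition C2_with_derivs_on ::
  "real set \<Rightarrow> (real \<Rightarrow> 'a::real_normed_vector) \<Rightarrow> (real \<Rightarrow> 'a) \<Rightarrow> (real \<Rightarrow> 'a) \<Rightarrow> bool" where
  "C2_with_derivs_on S f f' f'' \<longleftrightarrow>
     (\<forall>x\<in>S. (f has_vector_derivative f' x) (at x within S)) \<and>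
     (\<forall>x\<in>S. (f' has_vector_derivative f'' x) (at x within S)) \<and>
     continuous_on S f''"

text \<open>
  The scalar type is left open because eigenvalues are complex in general, while the
  principal eigenpair is real.  The zero function is not excluded here.
\<close>

definition eigen_problem ::
  "real \<Rightarrow> real \<Rightarrow> real \<Rightarrow> (real \<Rightarrow> real^2) \<Rightarrow> (real \<Rightarrow> real^2^2) \<Rightarrow>
     'a::real_normed_field \<Rightarrow> (real \<Rightarrow> 'a^2) \<Rightarrow> bool" where
  "eigen_problem l r d b M \<mu> \<phi> \<longleftrightarrow>
     (\<exists>\<phi>' \<phi>''. C2_with_derivs_on {l..r} \<phi> \<phi>' \<phi>'' \<and>
        (\<forall>x\<in>{l<..<r}. \<forall>i.
           - of_real d * \<phi>'' x $ i - of_real (b x $ i) * \<phi>' x $ i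
             + (\<Sum>j\<in>UNIV. of_real (M x $ i $ j) * \<phi> x $ j) = \<mu> * \<phi> x $ i) \<and>
        (\<forall>i. \<phi>' l $ i = 0 \<and> \<phi>' r $ i = 0))"

definition is_eigenvalue ::
  "real \<Rightarrow> real \<Rightarrow> real \<Rightarrow> (real \<Rightarrow> real^2) \<Rightarrow> (real \<Rightarrow> real^2^2) \<Rightarrow> complex \<Rightarrow> bool" where
  "is_eigenvalue l r d b M \<mu> \<longleftrightarrow>
     (\<exists>\<psi> :: real \<Rightarrow> complex^2. eigen_problem l r d b M \<mu> \<psi> \<and> (\<exists>x\<in>{l..r}. \<psi> x \<noteq> 0))"

text \<open>
  The real eigenvalue of smallest real part; at most one real number satisfies this.  Its
  existence and simplicity (Krein-Rutman) are consequences, not part of the definition.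
\<close>

definition is_principal_eigenvalue ::
  "real \<Rightarrow> real \<Rightarrow> real \<Rightarrow> (real \<Rightarrow> real^2) \<Rightarrow> (real \<Rightarrow> real^2^2) \<Rightarrow> real \<Rightarrow> bool" where
  "is_principal_eigenvalue l r d b M lam \<longleftrightarrow>
     is_eigenvalue l r d b M (complex_of_real lam) \<and>
     (\<forall>\<mu>. is_eigenvalue l r d b M \<mu> \<longrightarrow> lam \<le> Re \<mu>)"

definition is_principal_eigenfunction ::
  "real \<Rightarrow> real \<Rightarrow> real \<Rightarrow> (real \<Rightarrow> real^2) \<Rightarrow> (real \<Rightarrow> real^2^2) \<Rightarrow> (real \<Rightarrow> real^2) \<Rightarrow> bool" where
  "is_principal_eigenfunction l r d b M \<phi> \<longleftrightarrow>
     (\<exists>lam. is_principal_eigenvalue l r d b M lam \<and> eigen_problem l r d b M lam \<phi>) \<and>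
     (\<forall>x\<in>{l..r}. \<forall>i. \<phi> x $ i > 0)"

definition max_normalized :: "real \<Rightarrow> real \<Rightarrow> (real \<Rightarrow> real^2) \<Rightarrow> bool" where
  "max_normalized l r \<phi> \<longleftrightarrow>
     (\<forall>x\<in>{l..r}. \<forall>i. \<phi> x $ i \<le> 1) \<and> (\<exists>x\<in>{l..r}. \<exists>i. \<phi> x $ i = 1)"

definition log_transform :: "real \<Rightarrow> (real \<Rightarrow> real^2) \<Rightarrow> 2 \<Rightarrow> real \<Rightarrow> real" where
  "log_transform d \<phi> i x = - d * ln (\<phi> x $ i)"

definition Ham :: "(real \<Rightarrow> real^2) \<Rightarrow> real \<Rightarrow> real \<Rightarrow> real" where
  "Ham b x p = (MAX i\<in>UNIV. p\<^sup>2 - b x $ i * p)"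

text \<open>Outward derivative at the endpoint \<open>x\<close> of \<open>[l, r]\<close> of a function with derivative \<open>p\<close> there.\<close>

definition outward :: "real \<Rightarrow> real \<Rightarrow> real \<Rightarrow> real" where
  "outward l x p = (if x = l then - p else p)"

definition viscosity_subsolution ::
  "real \<Rightarrow> real \<Rightarrow> (real \<Rightarrow> real \<Rightarrow> real) \<Rightarrow> (real \<Rightarrow> real) \<Rightarrow> bool" where
  "viscosity_subsolution l r H W \<longleftrightarrow>
     continuous_on {l..r} W \<and>
     (\<forall>\<phi> \<phi>' \<phi>''. \<forall>x0\<in>{l..r}.
        C2_with_derivs_on {l..r} \<phi> \<phi>' \<phi>'' \<and>
        (\<forall>\<^sub>F y in at x0 within {l..r}. W y - \<phi> y \<le> W x0 - \<phi> x0) \<longrightarrow>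
        (x0 \<in> {l<..<r} \<longrightarrow> H x0 (\<phi>' x0) \<le> 0) \<and>
        (x0 \<in> {l, r} \<longrightarrow> min (H x0 (\<phi>' x0)) (outward l x0 (\<phi>' x0)) \<le> 0))"

definition viscosity_supersolution ::
  "real \<Rightarrow> real \<Rightarrow> (real \<Rightarrow> real \<Rightarrow> real) \<Rightarrow> (real \<Rightarrow> real) \<Rightarrow> bool" where
  "viscosity_supersolution l r H W \<longleftrightarrow>
     continuous_on {l..r} W \<and>
     (\<forall>\<phi> \<phi>' \<phi>''. \<forall>x0\<in>{l..r}.
        C2_with_derivs_on {l..r} \<phi> \<phi>' \<phi>'' \<and>
        (\<forall>\<^sub>F y in at x0 within {l..r}. W x0 - \<phi> x0 \<le> W y - \<phi> y) \<longrightarrow>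
        (x0 \<in> {l<..<r} \<longrightarrow> H x0 (\<phi>' x0) \<ge> 0) \<and>
        (x0 \<in> {l, r} \<longrightarrow> max (H x0 (\<phi>' x0)) (outward l x0 (\<phi>' x0)) \<ge> 0))"

definition viscosity_solution ::
  "real \<Rightarrow> real \<Rightarrow> (real \<Rightarrow> real \<Rightarrow> real) \<Rightarrow> (real \<Rightarrow> real) \<Rightarrow> bool" where
  "viscosity_solution l r H W \<longleftrightarrow>
     viscosity_subsolution l r H W \<and> viscosity_supersolution l r H W"

end

theory Submission
  imports Defs "HOL-Complex_Analysis.Great_Picard"
begin

text \<open>
  Put \<open>W\<^sub>i = - d log \<phi>\<^sub>i\<close>.  The eigenvalue problem becomes, for \<open>j \<noteq> i\<close>,
  \<open>W\<^sub>i'\<^sup>2 - b\<^sub>i W\<^sub>i' = d W\<^sub>i'' + d (M\<^sub>i\<^sub>i - \<lambda>) + d M\<^sub>i\<^sub>j exp ((W\<^sub>i - W\<^sub>j) / d)\<close>,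
  with \<open>W\<^sub>i' = 0\<close> at both endpoints and \<open>M\<^sub>i\<^sub>j < 0\<close>.  Every estimate is an evaluation of this
  identity at an extremum; the Neumann condition makes the endpoints harmless.

  Extrema of \<open>W\<close> bound \<open>\<lambda>\<close> independently of \<open>d\<close> (\<open>lam_lower\<close>, \<open>lam_upper\<close>).  At an interior extremum of
  \<open>W\<^sub>i'\<close> the term \<open>W\<^sub>i''\<close> vanishes and the coupling term has a sign, which bounds \<open>W\<^sub>i'\<close>
  (\<open>gradient_bound\<close>).  At a maximum of \<open>W\<^sub>i - W\<^sub>j\<close> the exponential \<open>exp ((W\<^sub>i - W\<^sub>j) / d)\<close> is at most
  a constant over \<open>d\<close>, so the two components become equal in the limit (\<open>component_gap\<close>).  With the
  normalization \<open>max \<phi>\<^sub>i = 1\<close>, the Arzela-Ascoli theorem yields a uniformly convergent subsequence with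
  a common Lipschitz limit, nonnegative and vanishing somewhere.

  The limit is a viscosity solution by the stability of local extrema under uniform convergence
  (\<open>perturbed_local_max\<close>, \<open>log_system_limit_viscosity\<close>).  For the subsolution property the coupling term
  has the right sign and is dropped.  For the supersolution property the test function touches the
  smaller component, where \<open>exp ((W\<^sub>i - W\<^sub>j) / d) \<le> 1\<close> and the coupling term is \<open>O(d)\<close>.
\<close>

section \<open>Derivative tests on a closed interval\<close>

text \<open>
  The tests below are one-sided at the endpoints of \<open>[a, b]\<close>.  At an endpoint a maximum only gives a
  sign of the first derivative; the second-derivative test holds there as well, as soon as the first
  derivative vanishes, which is what the Neumann condition provides.
\<close>

lemma first_derivative_test_interval:
  fixes f :: "real \<Rightarrow> real"
  assumes "a < b" "x \<in> {a..b}"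
    and f: "(f has_real_derivative D) (at x within {a..b})"
    and max: "\<forall>\<^sub>F y in at x within {a..b}. f y \<le> f x"
  shows "x < b \<Longrightarrow> D \<le> 0" "a < x \<Longrightarrow> 0 \<le> D"
proof -
  obtain e where e: "e > 0" "\<And>y. y \<in> {a..b} \<Longrightarrow> y \<noteq> x \<Longrightarrow> dist y x < e \<Longrightarrow> f y \<le> f x"
    using max unfolding eventually_at by auto
  show "D \<le> 0" if "x < b"
  proof (rule ccontr)
    assume "\<not> D \<le> 0"
    then obtain c where c: "c > 0" "\<And>h. h > 0 \<Longrightarrow> x + h \<in> {a..b} \<Longrightarrow> h < c \<Longrightarrow> f x < f (x + h)"
      using has_real_derivative_pos_inc_right[OF f] by auto
    define h where "h = min (min c e / 2) (b - x)"
    have h: "h > 0" "h < c" "h < e" "x + h \<in> {a..b}"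
      using c(1) e(1) that assms(2) by (auto simp: h_def min_def)
    show False
      using c(2)[OF h(1,4,2)] e(2)[OF h(4)] h by (auto simp: dist_real_def)
  qed
  show "0 \<le> D" if "a < x"
  proof (rule ccontr)
    assume "\<not> 0 \<le> D"
    then obtain c where c: "c > 0" "\<And>h. h > 0 \<Longrightarrow> x - h \<in> {a..b} \<Longrightarrow> h < c \<Longrightarrow> f x < f (x - h)"
      using has_real_derivative_neg_dec_left[OF f] by auto
    define h where "h = min (min c e / 2) (x - a)"
    have h: "h > 0" "h < c" "h < e" "x - h \<in> {a..b}"
      using c(1) e(1) that assms(2) by (auto simp: h_def min_def)
    show False
      using c(2)[OF h(1,4,2)] e(2)[OF h(4)] h by (auto simp: dist_real_def)
  qed
qed

lemma second_derivative_test_interval: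
  fixes f f' :: "real \<Rightarrow> real"
  assumes ab: "a < b" and x: "x \<in> {a..b}"
    and f: "\<And>y. y \<in> {a..b} \<Longrightarrow> (f has_real_derivative f' y) (at y within {a..b})"
    and f': "(f' has_real_derivative D) (at x within {a..b})"
    and crit: "f' x = 0"
    and max: "\<forall>\<^sub>F y in at x within {a..b}. f y \<le> f x"
  shows "D \<le> 0"
proof (rule ccontr)
  assume "\<not> D \<le> 0"
  then have "\<forall>\<^sub>F y in at x within {a..b}. 0 < (f' y - f' x) / (y - x)"
    using f' unfolding has_field_derivative_iff by (intro order_tendstoD(1)) auto
  with max have "\<forall>\<^sub>F y in at x within {a..b}. f y \<le> f x \<and> 0 < f' y / (y - x)"
    by eventually_elim (simp add: crit)
  then obtain e where e: "e > 0"
    "\<And>y. y \<in> {a..b} \<Longrightarrow> y \<noteq> x \<Longrightarrow> dist y x < e \<Longrightarrow> f y \<le> f x \<and> 0 < f' y / (y - x)"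
    unfolding eventually_at by auto
  show False
  proof (cases "x < b")
    case True
    define y where "y = min (x + e / 2) b"
    have y: "x < y" "y \<in> {a..b}" "dist y x < e"
      using True e(1) x by (auto simp: y_def dist_real_def min_def)
    have "\<exists>z\<in>{x<..<y}. f y - f x = (\<lambda>h. f' z * h) (y - x)"
      by (rule mvt_simple[OF y(1)])
         (use x y in \<open>auto simp flip: has_field_derivative_def intro!: DERIV_subset[OF f]\<close>)
    then obtain z where z: "z \<in> {x<..<y}" "f y - f x = f' z * (y - x)" by auto
    have "0 < f' z / (z - x)" using e(2)[of z] z y x by (auto simp: dist_real_def)
    then have "0 < f' z" using z by (simp add: zero_less_divide_iff)
    then have "0 < f y - f x" using z y(1) by simp
    then show False using e(2)[of y] y by auto
  next
    case False
    define y where "y = max (x - e / 2) a"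
    have y: "y < x" "y \<in> {a..b}" "dist y x < e"
      using False ab e(1) x by (auto simp: y_def dist_real_def max_def)
    have "\<exists>z\<in>{y<..<x}. f x - f y = (\<lambda>h. f' z * h) (x - y)"
      by (rule mvt_simple[OF y(1)])
         (use x y in \<open>auto simp flip: has_field_derivative_def intro!: DERIV_subset[OF f]\<close>)
    then obtain z where z: "z \<in> {y<..<x}" "f x - f y = f' z * (x - y)" by auto
    have "0 < f' z / (z - x)" using e(2)[of z] z y x by (auto simp: dist_real_def)
    then have "f' z < 0" using z by (simp add: zero_less_divide_iff)
    then have "f x - f y < 0" using z y(1) by (simp add: mult_neg_pos)
    then show False using e(2)[of y] y by auto
  qed
qed

section \<open>Stability of strict local maxima under uniform convergence\<close>

text \<open>
  A uniform limit with a local maximum at \<open>x0\<close> that is strict by a quadratic margin forces the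
  approximating functions to have local maxima arbitrarily close to \<open>x0\<close>: the maximum over a small
  ball around \<open>x0\<close> cannot lie on the boundary of that ball.
\<close>

lemma perturbed_local_max:
  fixes F :: "real \<Rightarrow> real" and G :: "nat \<Rightarrow> real \<Rightarrow> real"
  assumes S: "compact S" and cont: "\<And>k. continuous_on S (G k)"
    and lim: "uniform_limit S G F sequentially"
    and x0: "x0 \<in> S" and \<delta>: "\<delta> > 0"
    and strict: "\<And>y. y \<in> S \<Longrightarrow> \<bar>y - x0\<bar> < \<delta> \<Longrightarrow> F y + (y - x0)\<^sup>2 \<le> F x0"
    and e: "e > 0"
  shows "\<forall>\<^sub>F k in sequentially. \<exists>x\<in>S. \<bar>x - x0\<bar> < e \<and> (\<forall>\<^sub>F y in at x within S. G k y \<le> G k x)"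
proof -
  define \<rho> where "\<rho> = min e \<delta> / 2"
  have \<rho>: "\<rho> > 0" "\<rho> < e" "\<rho> < \<delta>" using e \<delta> by (auto simp: \<rho>_def min_def)
  have "\<forall>\<^sub>F k in sequentially. \<forall>x\<in>S. dist (G k x) (F x) < \<rho>\<^sup>2 / 2"
    using lim \<rho>(1) by (intro uniform_limitD) auto
  then show ?thesis
  proof eventually_elim
    case (elim k)
    have "compact (S \<inter> cball x0 \<rho>)" using S by (intro compact_Int_closed) auto
    moreover have "x0 \<in> S \<inter> cball x0 \<rho>" using x0 \<rho> by auto
    ultimately obtain x where x: "x \<in> S \<inter> cball x0 \<rho>" and mx: "\<And>y. y \<in> S \<inter> cball x0 \<rho> \<Longrightarrow> G k y \<le> G k x"
      using continuous_attains_sup[of "S \<inter> cball x0 \<rho>" "G k"] continuous_on_subset[OF cont[of k]]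
      by blast
    have le: "\<bar>x - x0\<bar> \<le> \<rho>" using x by (auto simp: dist_real_def)
    have "\<bar>x - x0\<bar> \<noteq> \<rho>"
    proof
      assume eq: "\<bar>x - x0\<bar> = \<rho>"
      have "F x + \<rho>\<^sup>2 \<le> F x0" using strict[of x] x eq \<rho> by (metis Int_iff power2_abs)
      moreover have "G k x0 \<le> G k x" using mx x0 \<rho> by auto
      moreover have "\<bar>G k x - F x\<bar> < \<rho>\<^sup>2 / 2" "\<bar>G k x0 - F x0\<bar> < \<rho>\<^sup>2 / 2"
        using elim x x0 by (auto simp: dist_real_def)
      ultimately show False by linarith
    qed
    then have lt: "\<bar>x - x0\<bar> < \<rho>" using le by simp
    have "\<forall>\<^sub>F y in at x within S. G k y \<le> G k x"
      unfolding eventually_at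
    proof (intro exI conjI ballI impI)
      show "0 < \<rho> - \<bar>x - x0\<bar>" using lt by simp
      fix y assume "y \<in> S" "y \<noteq> x \<and> dist y x < \<rho> - \<bar>x - x0\<bar>"
      then show "G k y \<le> G k x" by (intro mx) (auto simp: dist_real_def)
    qed
    then show ?case using x lt \<rho> by (intro bexI[of _ x]) auto
  qed
qed

section \<open>The logarithmically transformed system\<close>

text \<open>
  The system satisfied by \<open>W i = - d log \<phi>\<^sub>i\<close>, with first and second derivatives \<open>P\<close> and \<open>Q\<close>, for
  a positive solution \<open>\<phi>\<close> of the eigenvalue problem with eigenvalue \<open>lam\<close>.  Dividing the \<open>i\<close>-th
  equation by \<open>\<phi>\<^sub>i\<close> turns the coupling into \<open>exp ((W i - W j) / d) = \<phi>\<^sub>j / \<phi>\<^sub>i\<close>, where \<open>j\<close> is the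
  other component.  The equation is required on the closed interval.  The constants \<open>A\<close>, \<open>B\<close> and
  \<open>m\<close> bound the coefficients independently of \<open>d\<close>; \<open>m\<close> quantifies cooperativity.
\<close>

locale log_system =
  fixes l r d :: real and b :: "real \<Rightarrow> real^2" and M :: "real \<Rightarrow> real^2^2"
    and A B m lam :: real and W P Q :: "2 \<Rightarrow> real \<Rightarrow> real"
  assumes lr: "l < r" and d: "d > 0" and m: "m > 0"
    and W_deriv: "\<And>i x. x \<in> {l..r} \<Longrightarrow> (W i has_real_derivative P i x) (at x within {l..r})"
    and P_deriv: "\<And>i x. x \<in> {l..r} \<Longrightarrow> (P i has_real_derivative Q i x) (at x within {l..r})"
    and Neumann: "\<And>i. P i l = 0" "\<And>i. P i r = 0"
    and eqn: "\<And>i j x. x \<in> {l..r} \<Longrightarrow> i \<noteq> j \<Longrightarrow>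
      d * Q i x = (P i x)\<^sup>2 - b x $ i * P i x - d * (M x $ i $ i - lam)
        - d * (M x $ i $ j * exp ((W i x - W j x) / d))"
    and b_bound: "\<And>i x. x \<in> {l..r} \<Longrightarrow> \<bar>b x $ i\<bar> \<le> B"
    and M_bound: "\<And>i j x. x \<in> {l..r} \<Longrightarrow> \<bar>M x $ i $ j\<bar> \<le> A"
    and M_off: "\<And>i j x. x \<in> {l..r} \<Longrightarrow> i \<noteq> j \<Longrightarrow> M x $ i $ j \<le> - m"
begin

lemma W_cont: "continuous_on {l..r} (W i)"
  using W_deriv by (intro DERIV_continuous_on) auto

lemma P_cont: "continuous_on {l..r} (P i)"
  using P_deriv by (intro DERIV_continuous_on) auto

lemma bounds_nonneg: "0 \<le> A" "0 \<le> B"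
  using M_bound[of l 1 1] b_bound[of l 1] lr by auto

lemma obtain_other_component: obtains j :: 2 where "j \<noteq> i"
  using exhaust_2[of i] by (metis zero_neq_one)

text \<open>
  For \<open>u\<close> built linearly from \<open>W\<close> or from \<open>P\<close>, the premise on the endpoints comes from the Neumann
  condition or from an explicit case distinction.
\<close>

lemma critical_at_max:
  assumes x: "x \<in> {l..r}" and u: "(u has_real_derivative D) (at x within {l..r})"
    and ends: "x \<in> {l, r} \<Longrightarrow> D = 0"
    and max: "\<forall>\<^sub>F y in at x within {l..r}. u y \<le> u x"
  shows "D = 0"
  using first_derivative_test_interval[OF lr x u max] ends x by (cases "x \<in> {l, r}") auto

text \<open>
  At a joint minimum of both components over the interval, attained by component \<open>i\<close>, the coupling
  exponential is at most 1 and the curvature is nonnegative; this is the evaluation of the eigenvalue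
  equation at a joint maximum of the eigenfunction.
\<close>

lemma lam_lower: "- 2 * A \<le> lam"
proof -
  obtain i j :: 2 and x where x: "x \<in> {l..r}" "i \<noteq> j"
    and mn: "\<And>y. y \<in> {l..r} \<Longrightarrow> W i x \<le> W i y" and ij: "W i x \<le> W j x"
  proof -
    have "continuous_on {l..r} (\<lambda>x. min (W 1 x) (W 2 x))"
      by (intro continuous_intros W_cont)
    then obtain x where x: "x \<in> {l..r}"
      and mn: "\<And>y. y \<in> {l..r} \<Longrightarrow> min (W 1 x) (W 2 x) \<le> min (W 1 y) (W 2 y)"
      using continuous_attains_inf[of "{l..r}" "\<lambda>x. min (W 1 x) (W 2 x)"] lr by auto
    have "W 1 x \<le> W 1 y" if "W 1 x \<le> W 2 x" "y \<in> {l..r}" for y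
      using mn[OF that(2)] that(1) by linarith
    moreover have "W 2 x \<le> W 2 y" if "W 2 x \<le> W 1 x" "y \<in> {l..r}" for y
      using mn[OF that(2)] that(1) by linarith
    ultimately show thesis
      using that[of x 1 2] that[of x 2 1] x by (cases "W 1 x \<le> W 2 x") auto
  qed
  have ev: "\<forall>\<^sub>F y in at x within {l..r}. - W i y \<le> - W i x"
    using mn by (auto simp: eventually_at_filter)
  have nd: "((\<lambda>y. - W i y) has_real_derivative - P i y) (at y within {l..r})"
     "((\<lambda>y. - P i y) has_real_derivative - Q i y) (at y within {l..r})" if "y \<in> {l..r}" for y
    using W_deriv[OF that] P_deriv[OF that] by (auto intro: DERIV_minus)
  have "- P i x = 0"
    by (rule critical_at_max[OF x(1) nd(1)[OF x(1)] _ ev]) (use Neumann in auto)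
  then have "- Q i x \<le> 0"
    by (intro second_derivative_test_interval[OF lr x(1) nd(1) nd(2)[OF x(1)] _ ev])
  then have "0 \<le> d * Q i x" using d by simp
  also have "\<dots> = d * (lam - M x $ i $ i - M x $ i $ j * exp ((W i x - W j x) / d))"
    using eqn[OF x] \<open>- P i x = 0\<close> by (simp add: algebra_simps)
  finally have "0 \<le> lam - M x $ i $ i - M x $ i $ j * exp ((W i x - W j x) / d)"
    using d by (simp add: zero_le_mult_iff)
  moreover have "- M x $ i $ j * exp ((W i x - W j x) / d) \<le> A * 1"
    using M_bound[OF x(1), of i j] M_off[OF x] m ij d
    by (intro mult_mono) (auto simp: divide_le_0_iff)
  ultimately show ?thesis using M_bound[OF x(1), of i i] by simp
qed

text \<open>
  At a maximum of \<open>W 1\<close> the curvature is nonpositive and the coupling term has a favourable sign.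
\<close>

lemma lam_upper: "lam \<le> A"
proof -
  obtain x where x: "x \<in> {l..r}" and mx: "\<And>y. y \<in> {l..r} \<Longrightarrow> W 1 y \<le> W 1 x"
    using continuous_attains_sup[of "{l..r}" "W 1"] W_cont lr by auto
  have ev: "\<forall>\<^sub>F y in at x within {l..r}. W 1 y \<le> W 1 x"
    using mx by (auto simp: eventually_at_filter)
  have P0: "P 1 x = 0"
    by (rule critical_at_max[OF x W_deriv[OF x] _ ev]) (use Neumann in auto)
  then have "Q 1 x \<le> 0"
    by (intro second_derivative_test_interval[OF lr x W_deriv P_deriv[OF x] _ ev])
  then have "0 \<ge> d * Q 1 x" using d by (simp add: mult_le_0_iff)
  moreover have "d * Q 1 x = d * (lam - M x $ 1 $ 1 - M x $ 1 $ 2 * exp ((W 1 x - W 2 x) / d))"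
    using eqn[OF x, of 1 2] P0 by (simp add: algebra_simps)
  ultimately have "0 \<ge> lam - M x $ 1 $ 1 - M x $ 1 $ 2 * exp ((W 1 x - W 2 x) / d)"
    using d by (simp add: mult_le_0_iff)
  moreover have "M x $ 1 $ 2 * exp ((W 1 x - W 2 x) / d) \<le> 0"
    using M_off[OF x, of 1 2] m by (simp add: mult_le_0_iff)
  ultimately show ?thesis using M_bound[OF x, of 1 1] by simp
qed

text \<open>
  The coupling term has a sign, so each component is, up to \<open>O(d)\<close>, a subsolution of its own scalar
  equation.  The reverse inequality needs the coupling exponential to be bounded, which holds where
  the component is the smaller one.
\<close>

lemma curvature_lower:
  assumes x: "x \<in> {l..r}"
  shows "(P i x)\<^sup>2 - b x $ i * P i x \<le> d * Q i x + 3 * A * d"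
proof -
  obtain j where j: "j \<noteq> i" by (rule obtain_other_component)
  have "d * (M x $ i $ j * exp ((W i x - W j x) / d)) \<le> 0"
    using d m M_off[OF x j[symmetric]] by (simp add: mult_le_0_iff)
  moreover have "d * (M x $ i $ i - lam) \<le> d * (3 * A)"
    using d M_bound[OF x, of i i] lam_lower by (intro mult_left_mono) auto
  ultimately show ?thesis using eqn[OF x j[symmetric]] by (simp add: algebra_simps)
qed

lemma curvature_upper:
  assumes x: "x \<in> {l..r}" and ij: "\<And>j. W i x \<le> W j x"
  shows "d * Q i x - 3 * A * d \<le> (P i x)\<^sup>2 - b x $ i * P i x"
proof -
  obtain j where j: "j \<noteq> i" by (rule obtain_other_component)
  have "- M x $ i $ j * exp ((W i x - W j x) / d) \<le> A * 1"
    using M_bound[OF x, of i j] M_off[OF x j[symmetric]] m ij[of j] d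
    by (intro mult_mono) (auto simp: divide_le_0_iff)
  then have "d * (lam - M x $ i $ i - M x $ i $ j * exp ((W i x - W j x) / d)) \<le> d * (3 * A)"
    using d M_bound[OF x, of i i] lam_upper by (intro mult_left_mono) auto
  then show ?thesis using eqn[OF x j[symmetric]] by (simp add: algebra_simps)
qed

lemma gradient_at_critical:
  assumes x: "x \<in> {l..r}" and "Q i x = 0"
  shows "\<bar>P i x\<bar> \<le> B + 3 * A * d + 1"
proof (rule ccontr)
  let ?p = "\<bar>P i x\<bar>"
  assume *: "\<not> ?thesis"
  have nn: "0 \<le> 3 * A * d" using bounds_nonneg d by simp
  have p1: "1 \<le> ?p" using * nn bounds_nonneg by linarith
  have "b x $ i * P i x \<le> B * ?p"
    using b_bound[OF x, of i] by (metis abs_ge_self abs_ge_zero abs_mult mult_right_mono order_trans)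
  moreover have "3 * A * d \<le> 3 * A * d * ?p" using nn p1 by (simp add: mult_le_cancel_left1)
  ultimately have "?p * ?p \<le> (B + 3 * A * d) * ?p"
    using curvature_lower[OF x, of i] assms(2) by (simp add: power2_eq_square algebra_simps)
  then have "?p \<le> B + 3 * A * d" using p1 by (meson mult_right_le_imp_le less_le_trans zero_less_one)
  then show False using * by simp
qed

text \<open>
  Since \<open>P i\<close> vanishes at both endpoints, a nonzero extreme value of it is taken at an interior
  critical point, where the inequality of \<open>curvature_lower\<close> becomes quadratic in \<open>P i\<close> alone.
\<close>

lemma gradient_bound:
  assumes x: "x \<in> {l..r}"
  shows "\<bar>P i x\<bar> \<le> B + 3 * A * d + 1"
proof -
  let ?K = "B + 3 * A * d + 1"
  have K: "0 \<le> ?K" using bounds_nonneg d by simp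
  have *: "s * P i x \<le> ?K" if s: "\<bar>s\<bar> = 1" for s :: real
  proof -
    obtain y where y: "y \<in> {l..r}" and mx: "\<And>z. z \<in> {l..r} \<Longrightarrow> s * P i z \<le> s * P i y"
      using continuous_attains_sup[of "{l..r}" "\<lambda>z. s * P i z"] P_cont lr
      by (force intro: continuous_intros)
    have "s * P i y \<le> ?K"
    proof (cases "y \<in> {l, r}")
      case True then show ?thesis using Neumann K by auto
    next
      case False
      have "((\<lambda>z. s * P i z) has_real_derivative s * Q i y) (at y within {l..r})"
        using P_deriv[OF y] by (intro DERIV_cmult)
      moreover have "\<forall>\<^sub>F z in at y within {l..r}. s * P i z \<le> s * P i y"
        using mx by (auto simp: eventually_at_filter)
      ultimately have "s * Q i y = 0" using critical_at_max[OF y] False by blast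
      then have "\<bar>P i y\<bar> \<le> ?K" using gradient_at_critical[OF y] s by auto
      moreover have "s * P i y \<le> \<bar>s\<bar> * \<bar>P i y\<bar>" by (metis abs_ge_self abs_mult)
      ultimately show ?thesis using s by simp
    qed
    then show ?thesis using mx[OF x] by linarith
  qed
  show ?thesis using *[of 1] *[of "-1"] by auto
qed

lemma W_lipschitz:
  assumes "x \<in> {l..r}" "y \<in> {l..r}"
  shows "\<bar>W i x - W i y\<bar> \<le> (B + 3 * A * d + 1) * \<bar>x - y\<bar>"
  using field_differentiable_bound[of "{l..r}" "W i" "P i", OF _ W_deriv _ assms] gradient_bound
  by auto

text \<open>
  At a maximum of \<open>W i - W j\<close> the gradients agree and the curvatures are ordered.  Subtracting the
  two equations bounds \<open>d m exp ((W i - W j) / d)\<close> by a constant, so the gap is small with \<open>d\<close>.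
\<close>

lemma component_gap:
  assumes x: "x \<in> {l..r}"
  shows "(W i x - W j x)\<^sup>2 \<le> 2 * d * (2 * B * (B + 3 * A * d + 1) + 3 * A * d) / m"
proof -
  let ?K = "B + 3 * A * d + 1"
  let ?G = "2 * B * ?K + 3 * A * d"
  have G: "0 \<le> ?G" using bounds_nonneg d by simp
  have one: "W i x - W j x \<le> sqrt (2 * d * ?G / m)" if "i \<noteq> j" for i j
  proof -
    let ?u = "\<lambda>z. W i z - W j z"
    obtain y where y: "y \<in> {l..r}" and mx: "\<And>z. z \<in> {l..r} \<Longrightarrow> ?u z \<le> ?u y"
      using continuous_attains_sup[of "{l..r}" ?u] W_cont lr by (force intro: continuous_intros)
    have ev: "\<forall>\<^sub>F z in at y within {l..r}. ?u z \<le> ?u y"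
      using mx by (auto simp: eventually_at_filter)
    have der: "(?u has_real_derivative P i z - P j z) (at z within {l..r})"
      "((\<lambda>z. P i z - P j z) has_real_derivative Q i z - Q j z) (at z within {l..r})"
      if "z \<in> {l..r}" for z
      using W_deriv[OF that] P_deriv[OF that] by (auto intro: DERIV_diff)
    have crit: "P i y - P j y = 0"
      by (rule critical_at_max[OF y der(1)[OF y] _ ev]) (use Neumann in auto)
    then have "Q i y - Q j y \<le> 0"
      by (intro second_derivative_test_interval[OF lr y der(1) der(2)[OF y] _ ev])
    then have "d * Q i y \<le> d * Q j y" using d by simp
    then have le: "d * (- M y $ i $ j * exp (?u y / d))
      \<le> (b y $ i - b y $ j) * P i y + d * (M y $ i $ i - M y $ j $ j)
        + d * (- M y $ j $ i * exp ((W j y - W i y) / d))"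
      using eqn[OF y that] eqn[OF y that[symmetric]] crit by (simp add: algebra_simps)
    have "?u y \<le> sqrt (2 * d * ?G / m)"
    proof (cases "?u y \<le> 0")
      case True
      moreover have "0 \<le> sqrt (2 * d * ?G / m)" using G d m by simp
      ultimately show ?thesis by linarith
    next
      case False
      have "- M y $ j $ i * exp ((W j y - W i y) / d) \<le> A * 1"
        using M_bound[OF y, of j i] M_off[OF y that[symmetric]] m False d
        by (intro mult_mono) (auto simp: divide_le_0_iff)
      then have "d * (M y $ i $ i - M y $ j $ j)
          + d * (- M y $ j $ i * exp ((W j y - W i y) / d)) \<le> d * (2 * A) + d * A"
        using d M_bound[OF y, of i i] M_bound[OF y, of j j]
        by (intro add_mono mult_left_mono) auto
      moreover have "(b y $ i - b y $ j) * P i y \<le> (2 * B) * ?K"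
      proof -
        have "(b y $ i - b y $ j) * P i y \<le> \<bar>b y $ i - b y $ j\<bar> * \<bar>P i y\<bar>"
          by (metis abs_ge_self abs_mult)
        also have "\<dots> \<le> (2 * B) * ?K"
          using b_bound[OF y, of i] b_bound[OF y, of j] gradient_bound[OF y, of i]
          by (intro mult_mono) auto
        finally show ?thesis .
      qed
      ultimately have up: "d * (- M y $ i $ j * exp (?u y / d)) \<le> ?G"
        using le by simp
      \<comment> \<open>A quadratic lower bound for the exponential suffices and gives the rate \<open>sqrt d\<close>.\<close>
      have "(?u y / d)\<^sup>2 / 2 \<le> exp (?u y / d)"
      proof -
        have "0 < ?u y / d" using False d by (intro divide_pos_pos) auto
        then show ?thesis using exp_lower_Taylor_quadratic[of "?u y / d"] by linarith
      qed
      then have "m * ((?u y / d)\<^sup>2 / 2) \<le> - M y $ i $ j * exp (?u y / d)"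
        using M_off[OF y that] m by (intro mult_mono) auto
      then have "d * (m * ((?u y / d)\<^sup>2 / 2)) \<le> d * (- M y $ i $ j * exp (?u y / d))"
        using d by (intro mult_left_mono) auto
      then have "d * (m * ((?u y / d)\<^sup>2 / 2)) \<le> ?G" using up by linarith
      moreover have "d * (m * ((?u y / d)\<^sup>2 / 2)) = (?u y)\<^sup>2 * m / (2 * d)"
        using d by (simp add: power2_eq_square mult.commute)
      ultimately have "(?u y)\<^sup>2 * m / (2 * d) \<le> ?G" by simp
      then have "(?u y)\<^sup>2 \<le> 2 * d * ?G / m"
        using d m by (simp add: pos_divide_le_eq pos_le_divide_eq mult.commute)
      then show ?thesis by (rule real_le_rsqrt)
    qed
    then show ?thesis using mx[OF x] by linarith
  qed
  have nn: "0 \<le> 2 * d * ?G / m" using G d m by simp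
  show ?thesis
  proof (cases "i = j")
    case True then show ?thesis using nn by simp
  next
    case False
    have "\<bar>W i x - W j x\<bar> \<le> sqrt (2 * d * ?G / m)" using one[of i j] one[of j i] False by auto
    then have "(W i x - W j x)\<^sup>2 \<le> (sqrt (2 * d * ?G / m))\<^sup>2"
      by (metis abs_ge_zero power2_abs power_mono)
    then show ?thesis using nn by simp
  qed
qed

end

section \<open>Viscosity inequalities for the limit\<close>

text \<open>
  If a smooth \<open>\<theta>\<close> touches a component from above, it inherits the inequality of \<open>curvature_lower\<close>.  The
  premise on the endpoints excludes contact there: since \<open>P i\<close> vanishes at the endpoints, contact
  would give \<open>outward l x (\<theta>' x) \<le> 0\<close>.
\<close>

lemma (in log_system) touching_above:
  assumes x: "x \<in> {l..r}"
    and \<theta>: "\<And>y. y \<in> {l..r} \<Longrightarrow> (\<theta> has_real_derivative \<theta>' y) (at y within {l..r})"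
    and \<theta>': "(\<theta>' has_real_derivative D) (at x within {l..r})"
    and max: "\<forall>\<^sub>F y in at x within {l..r}. W i y - \<theta> y \<le> W i x - \<theta> x"
    and ends: "x \<in> {l, r} \<Longrightarrow> 0 < outward l x (\<theta>' x)"
  shows "(\<theta>' x)\<^sup>2 - b x $ i * \<theta>' x \<le> d * D + 3 * A * d"
proof -
  have der: "((\<lambda>y. W i y - \<theta> y) has_real_derivative P i y - \<theta>' y) (at y within {l..r})"
    if "y \<in> {l..r}" for y
    using W_deriv[OF that] \<theta>[OF that] by (rule DERIV_diff)
  note first = first_derivative_test_interval[OF lr x der[OF x] max]
  have "x \<notin> {l, r}"
    using first ends lr Neumann[of i] by (auto simp: outward_def)
  then have eq: "P i x - \<theta>' x = 0" using first x by auto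
  have "Q i x - D \<le> 0"
    by (rule second_derivative_test_interval[OF lr x der DERIV_diff[OF P_deriv[OF x] \<theta>'] eq max])
  then have "d * Q i x \<le> d * D" using d by simp
  then show ?thesis using curvature_lower[OF x, of i] eq by simp
qed

text \<open>
  From below the same works only for the smaller of the two components at the point of contact.
\<close>

lemma (in log_system) touching_below:
  assumes x: "x \<in> {l..r}"
    and \<theta>: "\<And>y. y \<in> {l..r} \<Longrightarrow> (\<theta> has_real_derivative \<theta>' y) (at y within {l..r})"
    and \<theta>': "(\<theta>' has_real_derivative D) (at x within {l..r})"
    and min: "\<forall>\<^sub>F y in at x within {l..r}. W i x - \<theta> x \<le> W i y - \<theta> y"
    and least: "\<And>j. W i x \<le> W j x"
    and ends: "x \<in> {l, r} \<Longrightarrow> outward l x (\<theta>' x) < 0"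
  shows "d * D - 3 * A * d \<le> (\<theta>' x)\<^sup>2 - b x $ i * \<theta>' x"
proof -
  have der: "((\<lambda>y. \<theta> y - W i y) has_real_derivative \<theta>' y - P i y) (at y within {l..r})"
    if "y \<in> {l..r}" for y
    using \<theta>[OF that] W_deriv[OF that] by (rule DERIV_diff)
  have max: "\<forall>\<^sub>F y in at x within {l..r}. \<theta> y - W i y \<le> \<theta> x - W i x"
    using min by eventually_elim simp
  note first = first_derivative_test_interval[OF lr x der[OF x] max]
  have "x \<notin> {l, r}"
    using first ends lr Neumann[of i] by (auto simp: outward_def)
  then have eq: "\<theta>' x - P i x = 0" using first x by auto
  have "D - Q i x \<le> 0"
    by (rule second_derivative_test_interval[OF lr x der DERIV_diff[OF \<theta>' P_deriv[OF x]] eq max])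
  then have "d * D \<le> d * Q i x" using d by simp
  then show ?thesis using curvature_upper[OF x least] eq by simp
qed

lemma Ham_eq_max: "Ham b x p = max (p\<^sup>2 - b x $ 1 * p) (p\<^sup>2 - b x $ 2 * p)"
  unfolding Ham_def UNIV_2 by simp

lemma endpoints_isolated:
  fixes l r x0 :: real
  assumes "l < r" "x0 \<in> {l..r}"
  obtains e where "e > 0" "\<And>x. x \<in> {l, r} \<Longrightarrow> \<bar>x - x0\<bar> < e \<Longrightarrow> x = x0"
proof
  let ?e = "if x0 \<in> {l, r} then r - l else min (x0 - l) (r - x0)"
  show "0 < ?e" using assms by auto
  show "x = x0" if "x \<in> {l, r}" "\<bar>x - x0\<bar> < ?e" for x using that assms by (auto split: if_splits)
qed

text \<open>
  The boundary condition \<open>min H (outward \<dots>) \<le> 0\<close> is proved by assuming \<open>outward \<dots> > 0\<close> and deducing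
  \<open>H \<le> 0\<close>; the supersolution condition is treated dually.  Contact of the test function with the
  approximations then never happens at an endpoint, and interior and boundary points are handled
  alike.  For subsolutions each component is tested separately, because every branch of the maximum
  in \<open>Ham\<close> must be nonpositive.  For supersolutions the test function touches the minimum of the two
  components from below, and one nonnegative branch is enough.
\<close>

lemma log_system_limit_viscosity:
  fixes W P Q :: "nat \<Rightarrow> 2 \<Rightarrow> real \<Rightarrow> real"
  assumes sys: "\<And>k. log_system l r (d k) b M A B m (lam k) (W k) (P k) (Q k)"
    and d0: "d \<longlonglongrightarrow> 0" and b: "continuous_on {l..r} b"
    and lim: "\<And>i. uniform_limit {l..r} (\<lambda>k. W k i) V sequentially"
  shows "viscosity_solution l r (Ham b) V"
proof -
  have lr: "l < r" and d: "d k > 0" for k using sys unfolding log_system_def by auto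
  have contV: "continuous_on {l..r} V"
    by (rule uniform_limit_theorem[OF _ lim[of 1]])
      (use log_system.W_cont[OF sys] in auto)
  have cont_minW: "continuous_on {l..r} (\<lambda>x. min (W k 1 x) (W k 2 x))" for k
    by (intro continuous_intros log_system.W_cont[OF sys])
  have lim_min: "uniform_limit {l..r} (\<lambda>k x. min (W k 1 x) (W k 2 x)) V sequentially"
  proof (rule uniform_limitI)
    fix e :: real assume "e > 0"
    from uniform_limitD[OF lim[of 1] this] uniform_limitD[OF lim[of 2] this]
    show "\<forall>\<^sub>F k in sequentially. \<forall>x\<in>{l..r}. dist (min (W k 1 x) (W k 2 x)) (V x) < e"
      by eventually_elim (auto simp: min_def)
  qed
  have main: "(x0 \<in> {l..r} \<longrightarrow> (x0 \<in> {l, r} \<longrightarrow> 0 < outward l x0 (\<psi>' x0)) \<longrightarrow>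
         (\<forall>\<^sub>F y in at x0 within {l..r}. V y - \<psi> y \<le> V x0 - \<psi> x0) \<longrightarrow> Ham b x0 (\<psi>' x0) \<le> 0) \<and>
      (x0 \<in> {l..r} \<longrightarrow> (x0 \<in> {l, r} \<longrightarrow> outward l x0 (\<psi>' x0) < 0) \<longrightarrow>
         (\<forall>\<^sub>F y in at x0 within {l..r}. V x0 - \<psi> x0 \<le> V y - \<psi> y) \<longrightarrow> 0 \<le> Ham b x0 (\<psi>' x0))"
    if \<psi>: "C2_with_derivs_on {l..r} \<psi> \<psi>' \<psi>''" for \<psi> \<psi>' \<psi>'' x0
  proof -
    have \<psi>1: "(\<psi> has_real_derivative \<psi>' x) (at x within {l..r})"
      and \<psi>2: "(\<psi>' has_real_derivative \<psi>'' x) (at x within {l..r})" if "x \<in> {l..r}" for x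
      using \<psi> that by (auto simp: C2_with_derivs_on_def has_real_derivative_iff_has_vector_derivative)
    have "bounded (\<psi>'' ` {l..r})"
      using \<psi> by (intro compact_imp_bounded compact_continuous_image) (auto simp: C2_with_derivs_on_def)
    then obtain C where C: "\<And>x. x \<in> {l..r} \<Longrightarrow> \<bar>\<psi>'' x\<bar> \<le> C"
      unfolding bounded_iff by (auto simp del: atLeastAtMost_iff)
    \<comment> \<open>With \<open>s = 1\<close> (maxima) or \<open>s = -1\<close> (minima), contact becomes strict and \<open>\<psi>' x0\<close> is unchanged.\<close>
    define \<theta> where "\<theta> s x = \<psi> x + s * (x - x0)\<^sup>2" for s x :: real
    define \<theta>' where "\<theta>' s x = \<psi>' x + 2 * s * (x - x0)" for s x :: real
    have \<theta>1: "(\<theta> s has_real_derivative \<theta>' s x) (at x within {l..r})"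
      and \<theta>2: "(\<theta>' s has_real_derivative \<psi>'' x + 2 * s) (at x within {l..r})"
      if "x \<in> {l..r}" for s x
      unfolding \<theta>_def \<theta>'_def using \<psi>1[OF that] \<psi>2[OF that]
      by (auto intro!: derivative_eq_intros)
    have \<theta>_cont: "continuous_on {l..r} (\<theta> s)" "continuous_on {l..r} (\<theta>' s)" for s
      by (rule DERIV_continuous_on[OF \<theta>1], simp) (rule DERIV_continuous_on[OF \<theta>2], simp)
    define h where "h s x = Ham b x (\<theta>' s x)" for s x
    have h_cont: "continuous_on {l..r} (h s)" for s
      unfolding h_def Ham_eq_max by (intro continuous_intros \<theta>_cont b)
    have h0: "h s x0 = Ham b x0 (\<psi>' x0)" and \<theta>'0: "\<theta>' s x0 = \<psi>' x0" for s
      by (auto simp: h_def \<theta>'_def)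
    have small: "\<forall>\<^sub>F k in sequentially. d k * (C + 2 + 3 * A) < c" if "c > 0" for c
    proof -
      have "(\<lambda>k. d k * (C + 2 + 3 * A)) \<longlonglongrightarrow> 0"
        using tendsto_mult_left_zero[OF d0] .
      then show ?thesis using that by (rule order_tendstoD)
    qed
    have sub: "Ham b x0 (\<psi>' x0) \<le> 0"
      if x0: "x0 \<in> {l..r}" and ends: "x0 \<in> {l, r} \<Longrightarrow> 0 < outward l x0 (\<psi>' x0)"
        and max: "\<forall>\<^sub>F y in at x0 within {l..r}. V y - \<psi> y \<le> V x0 - \<psi> x0"
    proof (rule ccontr)
      assume "\<not> ?thesis"
      then obtain i where pos: "0 < (\<psi>' x0)\<^sup>2 - b x0 $ i * \<psi>' x0"
        unfolding Ham_eq_max by (meson less_max_iff_disj not_le)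
      define q where "q x = (\<theta>' 1 x)\<^sup>2 - b x $ i * \<theta>' 1 x" for x
      have "continuous_on {l..r} q" unfolding q_def by (intro continuous_intros \<theta>_cont b)
      moreover have q0: "0 < q x0" using pos by (simp add: q_def \<theta>'0)
      ultimately obtain e1 where e1: "e1 > 0"
        "\<And>x. x \<in> {l..r} \<Longrightarrow> \<bar>x - x0\<bar> < e1 \<Longrightarrow> \<bar>q x - q x0\<bar> < q x0 / 2"
        using x0 unfolding continuous_on_iff dist_real_def by (meson half_gt_zero)
      obtain e2 where e2: "e2 > 0" "\<And>x. x \<in> {l, r} \<Longrightarrow> \<bar>x - x0\<bar> < e2 \<Longrightarrow> x = x0"
        using endpoints_isolated[OF lr x0] by blast
      obtain \<delta> where \<delta>: "\<delta> > 0" "\<And>y. y \<in> {l..r} \<Longrightarrow> \<bar>y - x0\<bar> < \<delta> \<Longrightarrow> V y - \<psi> y \<le> V x0 - \<psi> x0"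
        using max unfolding eventually_at dist_real_def by (metis order_refl)
      have "\<forall>\<^sub>F k in sequentially. \<exists>x\<in>{l..r}. \<bar>x - x0\<bar> < min e1 e2 \<and>
          (\<forall>\<^sub>F y in at x within {l..r}. W k i y - \<theta> 1 y \<le> W k i x - \<theta> 1 x)"
      proof (rule perturbed_local_max[OF _ _ _ x0 \<delta>(1)])
        show "continuous_on {l..r} (\<lambda>x. W k i x - \<theta> 1 x)" for k
          by (intro continuous_intros \<theta>_cont log_system.W_cont[OF sys])
        show "uniform_limit {l..r} (\<lambda>k x. W k i x - \<theta> 1 x) (\<lambda>x. V x - \<theta> 1 x) sequentially"
          by (intro uniform_limit_intros lim)
        show "V y - \<theta> 1 y + (y - x0)\<^sup>2 \<le> V x0 - \<theta> 1 x0" if "y \<in> {l..r}" "\<bar>y - x0\<bar> < \<delta>" for y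
          using \<delta>(2)[OF that] by (simp add: \<theta>_def)
      qed (use e1 e2 in auto)
      moreover have "\<forall>\<^sub>F k in sequentially. d k * (C + 2 + 3 * A) < q x0 / 2"
        using q0 by (intro small) simp
      ultimately have "\<forall>\<^sub>F k in sequentially. (\<exists>x\<in>{l..r}. \<bar>x - x0\<bar> < min e1 e2 \<and>
          (\<forall>\<^sub>F y in at x within {l..r}. W k i y - \<theta> 1 y \<le> W k i x - \<theta> 1 x))
          \<and> d k * (C + 2 + 3 * A) < q x0 / 2"
        by (rule eventually_conj)
      from eventually_happens'[OF sequentially_bot this]
      obtain k where k: "d k * (C + 2 + 3 * A) < q x0 / 2" and
        "\<exists>x\<in>{l..r}. \<bar>x - x0\<bar> < min e1 e2 \<and>
          (\<forall>\<^sub>F y in at x within {l..r}. W k i y - \<theta> 1 y \<le> W k i x - \<theta> 1 x)"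
        by (elim exE conjE)
      then obtain x where x: "x \<in> {l..r}" "\<bar>x - x0\<bar> < e1" "\<bar>x - x0\<bar> < e2"
        and mx: "\<forall>\<^sub>F y in at x within {l..r}. W k i y - \<theta> 1 y \<le> W k i x - \<theta> 1 x" by auto
      have ends_x: "0 < outward l x (\<theta>' 1 x)" if "x \<in> {l, r}"
        using e2(2)[OF that x(3)] ends that by (auto simp: \<theta>'0)
      have "q x \<le> d k * (\<psi>'' x + 2 * 1) + 3 * A * d k"
        unfolding q_def by (rule log_system.touching_above[OF sys x(1) _ \<theta>2[OF x(1)] mx ends_x]) (rule \<theta>1)
      also have "\<dots> = d k * (\<psi>'' x + 2 + 3 * A)" by (simp add: algebra_simps)
      also have "\<dots> \<le> d k * (C + 2 + 3 * A)"
        using d[of k] C[OF x(1)] by (intro mult_left_mono) auto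
      finally show False using k e1(2)[OF x(1,2)] by (auto simp: abs_if split: if_splits)
    qed
    have super: "0 \<le> Ham b x0 (\<psi>' x0)"
      if x0: "x0 \<in> {l..r}" and ends: "x0 \<in> {l, r} \<Longrightarrow> outward l x0 (\<psi>' x0) < 0"
        and min: "\<forall>\<^sub>F y in at x0 within {l..r}. V x0 - \<psi> x0 \<le> V y - \<psi> y"
    proof (rule ccontr)
      assume "\<not> ?thesis"
      then have neg: "0 < - h (-1) x0" by (simp add: h0)
      then obtain e1 where e1: "e1 > 0"
        "\<And>x. x \<in> {l..r} \<Longrightarrow> \<bar>x - x0\<bar> < e1 \<Longrightarrow> \<bar>h (-1) x - h (-1) x0\<bar> < - h (-1) x0 / 2"
        using x0 h_cont[of "-1"] unfolding continuous_on_iff dist_real_def by (meson half_gt_zero)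
      obtain e2 where e2: "e2 > 0" "\<And>x. x \<in> {l, r} \<Longrightarrow> \<bar>x - x0\<bar> < e2 \<Longrightarrow> x = x0"
        using endpoints_isolated[OF lr x0] by blast
      obtain \<delta> where \<delta>: "\<delta> > 0" "\<And>y. y \<in> {l..r} \<Longrightarrow> \<bar>y - x0\<bar> < \<delta> \<Longrightarrow> V x0 - \<psi> x0 \<le> V y - \<psi> y"
        using min unfolding eventually_at dist_real_def by (metis order_refl)
      let ?G = "\<lambda>k x. \<theta> (-1) x - Orderings.min (W k 1 x) (W k 2 x)"
      have "\<forall>\<^sub>F k in sequentially. \<exists>x\<in>{l..r}. \<bar>x - x0\<bar> < Orderings.min e1 e2 \<and>
          (\<forall>\<^sub>F y in at x within {l..r}. ?G k y \<le> ?G k x)"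
      proof (rule perturbed_local_max[OF _ _ _ x0 \<delta>(1)])
        show "continuous_on {l..r} (?G k)" for k
          by (intro continuous_on_diff \<theta>_cont cont_minW)
        show "uniform_limit {l..r} ?G (\<lambda>x. \<theta> (-1) x - V x) sequentially"
          by (intro uniform_limit_intros lim_min)
        show "\<theta> (-1) y - V y + (y - x0)\<^sup>2 \<le> \<theta> (-1) x0 - V x0" if "y \<in> {l..r}" "\<bar>y - x0\<bar> < \<delta>" for y
          using \<delta>(2)[OF that] by (simp add: \<theta>_def)
      qed (use e1 e2 in auto)
      moreover have "\<forall>\<^sub>F k in sequentially. d k * (C + 2 + 3 * A) < - h (-1) x0 / 2"
        using neg by (intro small) simp
      ultimately have "\<forall>\<^sub>F k in sequentially. (\<exists>x\<in>{l..r}. \<bar>x - x0\<bar> < Orderings.min e1 e2 \<and> (\<forall>\<^sub>F y in at x within {l..r}. ?G k y \<le> ?G k x))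
          \<and> d k * (C + 2 + 3 * A) < - h (-1) x0 / 2"
        by (rule eventually_conj)
      from eventually_happens'[OF sequentially_bot this]
      obtain k where k: "d k * (C + 2 + 3 * A) < - h (-1) x0 / 2" and
        "\<exists>x\<in>{l..r}. \<bar>x - x0\<bar> < Orderings.min e1 e2 \<and> (\<forall>\<^sub>F y in at x within {l..r}. ?G k y \<le> ?G k x)"
        by (elim exE conjE)
      then obtain x where x: "x \<in> {l..r}" "\<bar>x - x0\<bar> < e1" "\<bar>x - x0\<bar> < e2"
        and mx: "\<forall>\<^sub>F y in at x within {l..r}. ?G k y \<le> ?G k x" by auto
      obtain i where i: "\<And>j. W k i x \<le> W k j x"
        by (metis exhaust_2 linorder_le_cases order_refl)
      have least: "Orderings.min (W k 1 y) (W k 2 y) \<le> W k i y" for y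
        using exhaust_2[of i] by auto
      have at_x: "Orderings.min (W k 1 x) (W k 2 x) = W k i x"
        using i exhaust_2[of i] by (auto simp: min_def intro: antisym)
      have mn: "\<forall>\<^sub>F y in at x within {l..r}. W k i x - \<theta> (-1) x \<le> W k i y - \<theta> (-1) y"
        using mx
      proof eventually_elim
        case (elim y)
        then show ?case using least[of y] at_x by linarith
      qed
      have ends_x: "outward l x (\<theta>' (-1) x) < 0" if "x \<in> {l, r}"
        using e2(2)[OF that x(3)] ends that by (auto simp: \<theta>'0)
      have "d k * (\<psi>'' x + 2 * (-1)) - 3 * A * d k \<le> (\<theta>' (-1) x)\<^sup>2 - b x $ i * \<theta>' (-1) x"
        by (rule log_system.touching_below[OF sys x(1) _ \<theta>2[OF x(1)] mn i ends_x]) (rule \<theta>1)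
      also have "\<dots> \<le> h (-1) x"
        unfolding h_def Ham_eq_max using exhaust_2[of i] by auto
      also have "d k * (\<psi>'' x + 2 * (-1)) - 3 * A * d k = - (d k * (- \<psi>'' x + 2 + 3 * A))"
        by (simp add: algebra_simps)
      finally have "- h (-1) x \<le> d k * (- \<psi>'' x + 2 + 3 * A)" by simp
      also have "\<dots> \<le> d k * (C + 2 + 3 * A)"
        using d[of k] C[OF x(1)] by (intro mult_left_mono) auto
      finally show False using k e1(2)[OF x(1,2)] by (auto simp: abs_if split: if_splits)
    qed
    show ?thesis using sub super by blast
  qed
  show ?thesis
    unfolding viscosity_solution_def viscosity_subsolution_def viscosity_supersolution_def
  proof (intro conjI contV allI ballI impI)
    fix \<psi> \<psi>' \<psi>'' x0
    assume x0: "x0 \<in> {l..r}"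
    { assume *: "C2_with_derivs_on {l..r} \<psi> \<psi>' \<psi>'' \<and>
        (\<forall>\<^sub>F y in at x0 within {l..r}. V y - \<psi> y \<le> V x0 - \<psi> x0)"
      note m = main[THEN conjunct1, rule_format, OF conjunct1[OF *] x0 _ conjunct2[OF *]]
      show "Ham b x0 (\<psi>' x0) \<le> 0" if "x0 \<in> {l<..<r}" using m that by auto
      show "min (Ham b x0 (\<psi>' x0)) (outward l x0 (\<psi>' x0)) \<le> 0" if "x0 \<in> {l, r}"
        using m by (meson min_le_iff_disj not_le) }
    { assume *: "C2_with_derivs_on {l..r} \<psi> \<psi>' \<psi>'' \<and>
        (\<forall>\<^sub>F y in at x0 within {l..r}. V x0 - \<psi> x0 \<le> V y - \<psi> y)"
      note m = main[THEN conjunct2, rule_format, OF conjunct1[OF *] x0 _ conjunct2[OF *]]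
      show "0 \<le> Ham b x0 (\<psi>' x0)" if "x0 \<in> {l<..<r}" using m that by auto
      show "0 \<le> max (Ham b x0 (\<psi>' x0)) (outward l x0 (\<psi>' x0))" if "x0 \<in> {l, r}"
        using m by (meson le_max_iff_disj not_le) }
  qed
qed

section \<open>Positive eigenfunctions solve the transformed system\<close>

text \<open>
  The eigenvalue equation is imposed in the open interval only; continuity extends it to the
  endpoints, where the extremum arguments also use it.
\<close>

lemma eigen_problem_closed:
  fixes \<phi> \<phi>' \<phi>'' :: "real \<Rightarrow> real^2"
  assumes lr: "l < r" and C2: "C2_with_derivs_on {l..r} \<phi> \<phi>' \<phi>''"
    and b: "continuous_on {l..r} b" and M: "continuous_on {l..r} M"
    and eq: "\<And>x. x \<in> {l<..<r} \<Longrightarrow>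
      - d * \<phi>'' x $ i - b x $ i * \<phi>' x $ i + (\<Sum>j\<in>UNIV. M x $ i $ j * \<phi> x $ j) = lam * \<phi> x $ i"
    and x: "x \<in> {l..r}"
  shows "- d * \<phi>'' x $ i - b x $ i * \<phi>' x $ i + (\<Sum>j\<in>UNIV. M x $ i $ j * \<phi> x $ j) = lam * \<phi> x $ i"
proof -
  have cont: "continuous_on {l..r} \<phi>" "continuous_on {l..r} \<phi>'" "continuous_on {l..r} \<phi>''"
    using C2 by (auto simp: C2_with_derivs_on_def intro!: continuous_on_vector_derivative)
  define R where "R x = - d * \<phi>'' x $ i - b x $ i * \<phi>' x $ i
    + (\<Sum>j\<in>UNIV. M x $ i $ j * \<phi> x $ j) - lam * \<phi> x $ i" for x
  have "continuous_on (closure {l<..<r}) R"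
    unfolding R_def using lr cont b M by (auto intro!: continuous_intros)
  moreover have "R y = 0" if "y \<in> {l<..<r}" for y using eq[OF that] by (simp add: R_def)
  ultimately have "R x = 0"
    by (rule continuous_constant_on_closure[of "{l<..<r}"]) (use lr x in auto)
  then show ?thesis by (simp add: R_def)
qed

lemma eigenfunction_log_system:
  fixes \<phi> :: "real \<Rightarrow> real^2"
  assumes lr: "l < r" and d: "d > 0" and m: "m > 0"
    and b: "continuous_on {l..r} b" and M: "continuous_on {l..r} M"
    and b_bound: "\<And>i x. x \<in> {l..r} \<Longrightarrow> \<bar>b x $ i\<bar> \<le> B"
    and M_bound: "\<And>i j x. x \<in> {l..r} \<Longrightarrow> \<bar>M x $ i $ j\<bar> \<le> A"
    and M_off: "\<And>i j x. x \<in> {l..r} \<Longrightarrow> i \<noteq> j \<Longrightarrow> M x $ i $ j \<le> - m"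
    and eig: "eigen_problem l r d b M lam \<phi>"
    and pos: "\<And>i x. x \<in> {l..r} \<Longrightarrow> \<phi> x $ i > 0"
  obtains P Q where "log_system l r d b M A B m lam (log_transform d \<phi>) P Q"
proof -
  obtain \<phi>' \<phi>'' where C2: "C2_with_derivs_on {l..r} \<phi> \<phi>' \<phi>''"
    and eq: "\<And>x i. x \<in> {l<..<r} \<Longrightarrow>
      - d * \<phi>'' x $ i - b x $ i * \<phi>' x $ i + (\<Sum>j\<in>UNIV. M x $ i $ j * \<phi> x $ j) = lam * \<phi> x $ i"
    and N: "\<And>i. \<phi>' l $ i = 0 \<and> \<phi>' r $ i = 0"
    using eig unfolding eigen_problem_def by auto
  note eq_closed = eigen_problem_closed[OF lr C2 b M eq]
  have comp: "((\<lambda>x. \<phi> x $ i) has_real_derivative \<phi>' x $ i) (at x within {l..r})"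
    "((\<lambda>x. \<phi>' x $ i) has_real_derivative \<phi>'' x $ i) (at x within {l..r})" if "x \<in> {l..r}" for x i
    unfolding has_real_derivative_iff_has_vector_derivative
    using C2 that by (auto simp: C2_with_derivs_on_def
        intro!: bounded_linear.has_vector_derivative[OF bounded_linear_vec_nth])
  define P where "P i x = - d * (\<phi>' x $ i / \<phi> x $ i)" for i x
  define Q where "Q i x = - d * ((\<phi>'' x $ i * \<phi> x $ i - \<phi>' x $ i * \<phi>' x $ i) / (\<phi> x $ i * \<phi> x $ i))" for i x
  have "log_system l r d b M A B m lam (log_transform d \<phi>) P Q"
  proof (unfold_locales)
    fix i :: 2 and x assume x: "x \<in> {l..r}"
    show "(log_transform d \<phi> i has_real_derivative P i x) (at x within {l..r})"
      unfolding log_transform_def P_def using comp[OF x] pos[OF x]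
      by (auto intro!: derivative_eq_intros)
    show "(P i has_real_derivative Q i x) (at x within {l..r})"
      unfolding P_def Q_def using pos[OF x, of i]
      by (intro DERIV_cmult DERIV_divide comp[OF x]) auto
    fix j assume ij: "i \<noteq> j"
    have exp: "exp ((log_transform d \<phi> i x - log_transform d \<phi> j x) / d) = \<phi> x $ j / \<phi> x $ i"
    proof -
      have "(log_transform d \<phi> i x - log_transform d \<phi> j x) / d = ln (\<phi> x $ j) - ln (\<phi> x $ i)"
        using d by (simp add: log_transform_def field_simps)
      then show ?thesis using pos[OF x] by (simp add: exp_diff)
    qed
    have "(\<Sum>j\<in>UNIV. M x $ i $ j * \<phi> x $ j) = M x $ i $ i * \<phi> x $ i + M x $ i $ j * \<phi> x $ j"
      using exhaust_2[of i] exhaust_2[of j] ij by (auto simp: sum_2)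
    then have "d * \<phi>'' x $ i = - b x $ i * \<phi>' x $ i + M x $ i $ i * \<phi> x $ i + M x $ i $ j * \<phi> x $ j
        - lam * \<phi> x $ i"
      using eq_closed[OF _ x, of i] by simp
    then have ratio: "d * (\<phi>'' x $ i / \<phi> x $ i) = - b x $ i * (\<phi>' x $ i / \<phi> x $ i)
        + M x $ i $ i + M x $ i $ j * (\<phi> x $ j / \<phi> x $ i) - lam"
      using pos[OF x, of i] by (simp add: field_simps)
    have "d * Q i x = (P i x)\<^sup>2 - d * (d * (\<phi>'' x $ i / \<phi> x $ i))"
      unfolding Q_def P_def using pos[OF x, of i] by (simp add: field_simps power2_eq_square)
    then show "d * Q i x = (P i x)\<^sup>2 - b x $ i * P i x - d * (M x $ i $ i - lam)
        - d * (M x $ i $ j * exp ((log_transform d \<phi> i x - log_transform d \<phi> j x) / d))"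
      unfolding exp ratio by (simp add: P_def algebra_simps)
  qed (use assms N in \<open>auto simp: P_def\<close>)
  then show thesis by (rule that)
qed

section \<open>Compactness and conclusion\<close>

lemma C1_on_continuous: "C1_on S f \<Longrightarrow> continuous_on S f"
  unfolding C1_on_def by (auto intro: continuous_on_vector_derivative)

lemma uniform_limit_of_gap:
  fixes U V :: "nat \<Rightarrow> 'a \<Rightarrow> real"
  assumes U: "uniform_limit S U g sequentially" and \<epsilon>: "\<epsilon> \<longlonglongrightarrow> 0"
    and gap: "\<And>k x. x \<in> S \<Longrightarrow> \<bar>V k x - U k x\<bar> \<le> \<epsilon> k"
  shows "uniform_limit S V g sequentially"
proof (rule uniform_limitI)
  fix e :: real assume "e > 0"
  then have "\<forall>\<^sub>F k in sequentially. \<forall>x\<in>S. dist (U k x) (g x) < e / 2" "\<forall>\<^sub>F k in sequentially. \<epsilon> k < e / 2"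
    using uniform_limitD[OF U, of "e / 2"] order_tendstoD(2)[OF \<epsilon>, of "e / 2"] by auto
  then show "\<forall>\<^sub>F k in sequentially. \<forall>x\<in>S. dist (V k x) (g x) < e"
  proof eventually_elim
    case (elim k)
    show ?case
    proof
      fix x assume "x \<in> S"
      then show "dist (V k x) (g x) < e"
        using elim gap[of x k] unfolding dist_real_def by (smt (verit) field_sum_of_halves)
    qed
  qed
qed

theorem theorem1p1:
  fixes l r :: real
    and b :: "real \<Rightarrow> real^2"
    and M :: "real \<Rightarrow> real^2^2"
    and \<phi> :: "real \<Rightarrow> real \<Rightarrow> real^2"
    and d :: "nat \<Rightarrow> real"
  assumes "l < r"
    and "C1_on {l..r} b"
    and "C1_on {l..r} M"
    and "\<forall>x\<in>{l..r}. M x $ 1 $ 2 < 0 \<and> M x $ 2 $ 1 < 0"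
    and "\<forall>\<delta>>0. is_principal_eigenfunction l r \<delta> b M (\<phi> \<delta>) \<and> max_normalized l r (\<phi> \<delta>)"
    and "\<forall>k. d k > 0" and "decseq d" and "d \<longlonglongrightarrow> 0"
  shows "\<exists>s W. strict_mono (s :: nat \<Rightarrow> nat)
    \<and> (\<forall>i. uniform_limit {l..r} (\<lambda>k. log_transform (d (s k)) (\<phi> (d (s k))) i) W sequentially)
    \<and> (\<exists>C. C-lipschitz_on {l..r} W)
    \<and> viscosity_solution l r (Ham b) W
    \<and> (\<forall>x\<in>{l..r}. 0 \<le> W x) \<and> (\<exists>x\<in>{l..r}. W x = 0)"
proof -
  note lr = \<open>l < r\<close>
  have b: "continuous_on {l..r} b" and M: "continuous_on {l..r} M"
    using assms(2,3) by (auto intro: C1_on_continuous)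
  obtain B where B: "\<And>x i. x \<in> {l..r} \<Longrightarrow> \<bar>b x $ i\<bar> \<le> B"
  proof -
    have "bounded (b ` {l..r})" by (intro compact_imp_bounded compact_continuous_image b) auto
    then obtain B where "\<forall>x\<in>{l..r}. norm (b x) \<le> B" unfolding bounded_iff by blast
    then show thesis using that component_le_norm_cart order_trans by blast
  qed
  obtain A where A: "\<And>x i j. x \<in> {l..r} \<Longrightarrow> \<bar>M x $ i $ j\<bar> \<le> A"
  proof -
    have "bounded (M ` {l..r})" by (intro compact_imp_bounded compact_continuous_image M) auto
    then obtain A where "\<forall>x\<in>{l..r}. norm (M x) \<le> A" unfolding bounded_iff by blast
    then show thesis
      using that component_le_norm_cart Finite_Cartesian_Product.norm_nth_le order_trans by meson
  qed
  obtain m where m: "m > 0" "\<And>x i j. x \<in> {l..r} \<Longrightarrow> i \<noteq> j \<Longrightarrow> M x $ i $ j \<le> - m"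
  proof -
    have "continuous_on {l..r} (\<lambda>x. min (- M x $ 1 $ 2) (- M x $ 2 $ 1))"
      by (intro continuous_intros M)
    then obtain y where y: "y \<in> {l..r}"
      "\<And>x. x \<in> {l..r} \<Longrightarrow> min (- M y $ 1 $ 2) (- M y $ 2 $ 1) \<le> min (- M x $ 1 $ 2) (- M x $ 2 $ 1)"
      using continuous_attains_inf[of "{l..r}" "\<lambda>x. min (- M x $ 1 $ 2) (- M x $ 2 $ 1)"] lr by auto
    show thesis
    proof (rule that[of "min (- M y $ 1 $ 2) (- M y $ 2 $ 1)"])
      show "0 < min (- M y $ 1 $ 2) (- M y $ 2 $ 1)" using y(1) assms(4) by auto
      show "M x $ i $ j \<le> - min (- M y $ 1 $ 2) (- M y $ 2 $ 1)" if "x \<in> {l..r}" "i \<noteq> j" for x i j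
        using y(2)[OF that(1)] that(2) exhaust_2[of i] exhaust_2[of j] by auto
    qed
  qed
  define W where "W k = log_transform (d k) (\<phi> (d k))" for k
  have pos: "\<phi> (d k) x $ i > 0" and norm: "max_normalized l r (\<phi> (d k))" if "x \<in> {l..r}" for k x i
    using assms(5,6) that by (auto simp: is_principal_eigenfunction_def)
  have "\<exists>lam P Q. log_system l r (d k) b M A B m lam (W k) P Q" for k
  proof -
    obtain lam where "eigen_problem l r (d k) b M lam (\<phi> (d k))"
      using assms(5,6) unfolding is_principal_eigenfunction_def by blast
    from eigenfunction_log_system[OF lr _ m(1) b M B A m(2) this pos] assms(6)
    show ?thesis unfolding W_def by metis
  qed
  then obtain lam P Q where sys: "\<And>k. log_system l r (d k) b M A B m (lam k) (W k) (P k) (Q k)"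
    by metis
  have AB: "0 \<le> A" "0 \<le> B" using log_system.bounds_nonneg[OF sys] by auto
  \<comment> \<open>\<open>d 0\<close> is the largest of the \<open>d k\<close>, so these constants serve for every \<open>k\<close>.\<close>
  define K where "K = B + 3 * A * d 0 + 1"
  define G where "G = 2 * B * K + 3 * A * d 0"
  define \<epsilon> where "\<epsilon> k = sqrt (2 * d k * G / m)" for k
  have dk: "0 < d k" "d k \<le> d 0" for k using assms(6) decseqD[OF assms(7), of 0 k] by auto
  have K0: "0 \<le> K" using AB dk(1)[of 0] by (simp add: K_def)
  have G0: "0 \<le> G" using AB K0 dk(1)[of 0] by (simp add: G_def)
  have Kk: "B + 3 * A * d k + 1 \<le> K" for k
    using AB dk[of k] by (simp add: K_def mult_left_mono)
  have lip: "\<bar>W k i x - W k i y\<bar> \<le> K * \<bar>x - y\<bar>" if "x \<in> {l..r}" "y \<in> {l..r}" for k i x y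
    using log_system.W_lipschitz[OF sys that, of k i] mult_right_mono[OF Kk abs_ge_zero, of k "x - y"]
    by linarith
  have gap: "\<bar>W k i x - W k j x\<bar> \<le> \<epsilon> k" if "x \<in> {l..r}" for k i j x
  proof -
    have "2 * B * (B + 3 * A * d k + 1) + 3 * A * d k \<le> G"
      unfolding G_def using AB dk[of k] Kk[of k] by (intro add_mono mult_left_mono) auto
    then have "2 * d k * (2 * B * (B + 3 * A * d k + 1) + 3 * A * d k) / m \<le> 2 * d k * G / m"
      using dk(1)[of k] m(1) by (intro divide_right_mono mult_left_mono) auto
    then have "(W k i x - W k j x)\<^sup>2 \<le> 2 * d k * G / m"
      using log_system.component_gap[OF sys that, of k i j] by linarith
    then show ?thesis unfolding \<epsilon>_def by (intro real_le_rsqrt) simp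
  qed
  have \<epsilon>: "\<epsilon> \<longlonglongrightarrow> 0"
  proof -
    have "\<epsilon> \<longlonglongrightarrow> sqrt (2 * 0 * G / m)"
      unfolding \<epsilon>_def by (intro tendsto_intros assms(8)) (use m in auto)
    then show ?thesis by simp
  qed
  have W_nonneg: "0 \<le> W k i x" if "x \<in> {l..r}" for k i x
    using norm[OF that, of k] pos[OF that, of k i] dk(1)[of k] that
    by (auto simp: W_def log_transform_def max_normalized_def mult_le_0_iff)
  have W_zero: "\<exists>x\<in>{l..r}. \<exists>i. W k i x = 0" for k
    using norm[of l k] lr unfolding max_normalized_def W_def log_transform_def
    by (metis atLeastAtMost_iff less_imp_le ln_one mult_zero_right order_refl)
  have W_bound: "\<bar>W k 1 x\<bar> \<le> \<epsilon> 0 + K * (r - l)" if x: "x \<in> {l..r}" for k x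
  proof -
    obtain y i where y: "y \<in> {l..r}" "W k i y = 0" using W_zero by blast
    have "\<epsilon> k \<le> \<epsilon> 0"
      unfolding \<epsilon>_def using dk[of k] G0 m(1)
      by (intro real_sqrt_le_mono divide_right_mono mult_right_mono) auto
    moreover have "K * \<bar>x - y\<bar> \<le> K * (r - l)"
      using K0 x y(1) by (intro mult_left_mono) auto
    ultimately show ?thesis using lip[OF x y(1), of k 1] gap[OF y(1), of k 1 i] y(2) by linarith
  qed
  obtain g s where g: "continuous_on {l..r} g" and s: "strict_mono (s :: nat \<Rightarrow> nat)"
    and conv: "\<And>e. 0 < e \<Longrightarrow> \<exists>N. \<forall>n x. n \<ge> N \<and> x \<in> {l..r} \<longrightarrow> norm (W (s n) 1 x - g x) < e"
  proof (rule Arzela_Ascoli[of "{l..r}" "\<lambda>k. W k 1" "\<epsilon> 0 + K * (r - l)"])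
    show "\<exists>\<delta>. 0 < \<delta> \<and> (\<forall>n y. y \<in> {l..r} \<and> norm (x - y) < \<delta> \<longrightarrow> norm (W n 1 x - W n 1 y) < e)"
      if "x \<in> {l..r}" "0 < e" for x e
    proof (intro exI conjI allI impI)
      show "0 < e / (K + 1)" using that K0 by simp
      fix n y assume y: "y \<in> {l..r} \<and> norm (x - y) < e / (K + 1)"
      have "K * \<bar>x - y\<bar> \<le> (K + 1) * \<bar>x - y\<bar>" by (intro mult_right_mono) auto
      also have "\<dots> < e" using y K0 by (simp add: pos_less_divide_eq mult.commute)
      finally show "norm (W n 1 x - W n 1 y) < e" using lip[OF that(1), of y n 1] y by auto
    qed
  qed (use W_bound in auto)
  have lim1: "uniform_limit {l..r} (\<lambda>k. W (s k) 1) g sequentially"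
    unfolding uniform_limit_iff eventually_sequentially dist_norm using conv by blast
  have lim: "uniform_limit {l..r} (\<lambda>k. W (s k) i) g sequentially" for i
    by (rule uniform_limit_of_gap[OF lim1 LIMSEQ_subseq_LIMSEQ[OF \<epsilon> s]]) (use gap in auto)
  have ptw: "(\<lambda>k. W (s k) i x) \<longlonglongrightarrow> g x" if "x \<in> {l..r}" for i x
    using tendsto_uniform_limitI[OF lim that] .
  have "K-lipschitz_on {l..r} g"
  proof (rule lipschitz_onI[OF _ K0])
    fix x y assume xy: "x \<in> {l..r}" "y \<in> {l..r}"
    have "(\<lambda>k. \<bar>W (s k) 1 x - W (s k) 1 y\<bar>) \<longlonglongrightarrow> \<bar>g x - g y\<bar>"
      by (intro tendsto_intros ptw xy)
    then show "dist (g x) (g y) \<le> K * dist x y"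
      unfolding dist_real_def using lip[OF xy] by (intro LIMSEQ_le_const2) auto
  qed
  moreover have "viscosity_solution l r (Ham b) g"
    by (rule log_system_limit_viscosity[where W = "\<lambda>k. W (s k)" and d = "\<lambda>k. d (s k)"])
      (use sys lim b LIMSEQ_subseq_LIMSEQ[OF assms(8) s] in \<open>auto simp: o_def\<close>)
  moreover have nonneg: "0 \<le> g x" if "x \<in> {l..r}" for x
    using ptw[OF that, of 1] W_nonneg[OF that] by (intro LIMSEQ_le_const) auto
  moreover have "\<exists>x\<in>{l..r}. g x = 0"
  proof -
    obtain x where x: "x \<in> {l..r}" "\<And>y. y \<in> {l..r} \<Longrightarrow> g x \<le> g y"
      using continuous_attains_inf[of "{l..r}" g] g lr by auto
    have "g x \<le> e" if "e > 0" for e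
    proof -
      have "\<forall>\<^sub>F k in sequentially. \<forall>i. \<forall>y\<in>{l..r}. dist (W (s k) i y) (g y) < e"
        using lim that by (intro eventually_all_finite uniform_limitD)
      then obtain k where k: "\<And>i y. y \<in> {l..r} \<Longrightarrow> dist (W (s k) i y) (g y) < e"
        using eventually_happens'[OF sequentially_bot] by blast
      obtain y i where y: "y \<in> {l..r}" "W (s k) i y = 0" using W_zero by blast
      show ?thesis using k[OF y(1), of i] x(2)[OF y(1)] y(2) by (simp add: dist_real_def)
    qed
    then have "g x \<le> 0" by (rule field_le_epsilon) simp
    then show ?thesis using x(1) nonneg[OF x(1)] by (intro bexI[of _ x]) auto
  qed
  ultimately show ?thesis using s lim unfolding W_def by blast
qed

end
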